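(* Let $\mathcal{H}_1$ and $\mathcal{H}_2$ be complex Hilbert spaces, let $A\in\mathcal{B}(\mathcal{H}_1)$, $B\in\mathcal{B}(\mathcal{H}_2,\mathcal{H}_1)$, $C\in\mathcal{B}(\mathcal{H}_1,\mathcal{H}_2)$, $D\in\mathcal{B}(\mathcal{H}_2)$, and let $q\in[0,1]$. Then the following inequalities hold: (i) $\displaystyle \max\left\{\omega_q(A),\ \omega_q(D),\ \omega_q\left(\begin{bmatrix}0&B\\C&0\end{bmatrix}\right)\right\}\le\omega_q\left(\begin{bmatrix}A&B\\C&D\end{bmatrix}\right)$; (ii) $\displaystyle \omega_q\left(\begin{bmatrix}A&B\\C&D\end{bmatrix}\right)\le\max\{\|A\|,\|D\|\}+\left(1-\frac{3q^2}{4}+q\sqrt{1-q^2}\right)^{\frac12}\left(\|B\|+\|C\|\right)$; (iii) $\displaystyle \omega_q\left(\begin{bmatrix}A&B\\C&D\end{bmatrix}\right)\le\sqrt{1-q^2}\left(\|A\|^2+\|B\|^2+\|C\|^2+\|D\|^2\right)^{\frac12}+q\left(\max\{\omega(A),\omega(D)\}+\frac{\|B\|+\|C\|}{2}\right)$.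
   Context: $\mathcal{B}(\mathcal{H},\mathcal{K})$ denotes the bounded linear operators from $\mathcal{H}$ to $\mathcal{K}$, $\mathcal{B}(\mathcal{H})=\mathcal{B}(\mathcal{H},\mathcal{H})$, and $\|\cdot\|$ is the operator norm. $\mathcal{H}_1\oplus\mathcal{H}_2$ is the Hilbert space direct sum, and $\begin{bmatrix}A&B\\C&D\end{bmatrix}$ is the bounded operator on it sending $(x_1,x_2)$ to $(Ax_1+Bx_2,\ Cx_1+Dx_2)$. For a bounded operator $T$ on a complex Hilbert space $\mathcal{H}$, the numerical radius is $\omega(T)=\sup\{|\langle Tx,x\rangle| : x\in\mathcal{H},\ \|x\|=1\}$, and for $q\in[0,1]$ the $q$-numerical radius is $\omega_q(T)=\sup\{|\langle Tx,y\rangle| : x,y\in\mathcal{H},\ \|x\|=\|y\|=1,\ \langle x,y\rangle=q\}$. Suprema over empty sets (which occur only when $\dim\mathcal{H}=0$, or $\dim\mathcal{H}=1$ and $q<1$) are read as $0$. *)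

theory Defs
  imports "HOL-Analysis.Analysis"
begin

text \<open>
  Complex inner product spaces: a complex vector space whose scalar multiplication extends the
  real one and whose norm is induced by a sesquilinear inner product, linear in the first argument.
\<close>

class complex_inner = real_normed_vector +
  fixes scaleC :: "complex \<Rightarrow> 'a \<Rightarrow> 'a" (infixr "*\<^sub>C" 75)
    and cinner :: "'a \<Rightarrow> 'a \<Rightarrow> complex"
  assumes scaleC_add_right: "c *\<^sub>C (x + y) = c *\<^sub>C x + c *\<^sub>C y"
    and scaleC_add_left: "(c + d) *\<^sub>C x = c *\<^sub>C x + d *\<^sub>C x"
    and scaleC_scaleC: "c *\<^sub>C d *\<^sub>C x = (c * d) *\<^sub>C x"
    and scaleC_one: "1 *\<^sub>C x = x"
    and scaleR_scaleC: "r *\<^sub>R x = complex_of_real r *\<^sub>C x"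
    and cinner_commute: "cinner x y = cnj (cinner y x)"
    and cinner_add_left: "cinner (x + y) z = cinner x z + cinner y z"
    and cinner_scaleC_left: "cinner (c *\<^sub>C x) y = c * cinner x y"
    and cinner_ge_zero: "0 \<le> Re (cinner x x)"
    and cinner_eq_zero_iff: "cinner x x = 0 \<longleftrightarrow> x = 0"
    and norm_eq_sqrt_cinner: "norm x = sqrt (Re (cinner x x))"

class chilbert_space = complex_inner + complete_space

instantiation complex :: chilbert_space
begin

definition scaleC_complex :: "complex \<Rightarrow> complex \<Rightarrow> complex"
  where "scaleC_complex c x = c * x"

definition cinner_complex :: "complex \<Rightarrow> complex \<Rightarrow> complex"
  where "cinner_complex x y = x * cnj y"

instance
  by standard
    (auto simp: scaleC_complex_def cinner_complex_def algebra_simps scaleR_conv_of_real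
      cmod_def power2_eq_square complex_eq_iff)

end

text \<open>
  The direct sum is the product type; its norm, inherited from the real normed
  structure on products, is the one induced by the inner product below.
\<close>

instantiation prod :: (complex_inner, complex_inner) complex_inner
begin

definition scaleC_prod :: "complex \<Rightarrow> 'a \<times> 'b \<Rightarrow> 'a \<times> 'b"
  where "scaleC_prod c x = (c *\<^sub>C fst x, c *\<^sub>C snd x)"

definition cinner_prod :: "'a \<times> 'b \<Rightarrow> 'a \<times> 'b \<Rightarrow> complex"
  where "cinner_prod x y = cinner (fst x) (fst y) + cinner (snd x) (snd y)"

instance
proof
  fix c d :: complex and r :: real and x y z :: "'a \<times> 'b"
  show "c *\<^sub>C (x + y) = c *\<^sub>C x + c *\<^sub>C y"
    by (simp add: scaleC_prod_def scaleC_add_right)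
  show "(c + d) *\<^sub>C x = c *\<^sub>C x + d *\<^sub>C x"
    by (simp add: scaleC_prod_def scaleC_add_left)
  show "c *\<^sub>C d *\<^sub>C x = (c * d) *\<^sub>C x"
    by (simp add: scaleC_prod_def scaleC_scaleC)
  show "1 *\<^sub>C x = x"
    by (simp add: scaleC_prod_def scaleC_one)
  show "r *\<^sub>R x = complex_of_real r *\<^sub>C x"
    by (simp add: scaleC_prod_def scaleR_prod_def scaleR_scaleC)
  show "cinner x y = cnj (cinner y x)"
    unfolding cinner_prod_def complex_cnj_add
    by (simp only: cinner_commute [symmetric])
  show "cinner (x + y) z = cinner x z + cinner y z"
    by (simp add: cinner_prod_def cinner_add_left)
  show "cinner (c *\<^sub>C x) y = c * cinner x y"
    by (simp add: cinner_prod_def scaleC_prod_def cinner_scaleC_left algebra_simps)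
  show "0 \<le> Re (cinner x x)"
    by (simp add: cinner_prod_def cinner_ge_zero)
  have nrm: "Re (cinner u u) = (norm u)\<^sup>2" for u :: "'c::complex_inner"
    by (simp add: norm_eq_sqrt_cinner cinner_ge_zero)
  show "norm x = sqrt (Re (cinner x x))"
    by (simp add: cinner_prod_def norm_prod_def nrm)
  show "cinner x x = 0 \<longleftrightarrow> x = 0"
  proof
    assume "cinner x x = 0"
    then have "(norm (fst x))\<^sup>2 + (norm (snd x))\<^sup>2 = 0"
      by (metis cinner_prod_def nrm plus_complex.simps(1) zero_complex.simps(1))
    then show "x = 0"
      by (simp add: sum_power2_eq_zero_iff prod_eq_iff)
  next
    assume "x = 0"
    then show "cinner x x = 0"
      using cinner_eq_zero_iff [of "0::'a"] cinner_eq_zero_iff [of "0::'b"]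
      by (simp add: cinner_prod_def)
  qed
qed

end

instance prod :: (chilbert_space, chilbert_space) chilbert_space ..

definition bounded_clinear :: "('a::complex_inner \<Rightarrow> 'b::complex_inner) \<Rightarrow> bool"
  where "bounded_clinear T \<longleftrightarrow> bounded_linear T \<and> (\<forall>c x. T (c *\<^sub>C x) = c *\<^sub>C T x)"

definition block_op ::
  "('a \<Rightarrow> 'a) \<Rightarrow> ('b \<Rightarrow> 'a) \<Rightarrow> ('a \<Rightarrow> 'b) \<Rightarrow> ('b \<Rightarrow> 'b) \<Rightarrow>
    'a::complex_inner \<times> 'b::complex_inner \<Rightarrow> 'a \<times> 'b"
  where "block_op A B C D = (\<lambda>(x\<^sub>1, x\<^sub>2). (A x\<^sub>1 + B x\<^sub>2, C x\<^sub>1 + D x\<^sub>2))"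

lemma bounded_clinear_block_op:
  assumes "bounded_clinear A" "bounded_clinear B" "bounded_clinear C" "bounded_clinear D"
  shows "bounded_clinear (block_op A B C D)"
proof -
  note lin = assms [unfolded bounded_clinear_def]
  have *: "block_op A B C D = (\<lambda>x. (A (fst x) + B (snd x), C (fst x) + D (snd x)))"
    by (simp add: block_op_def case_prod_unfold)
  have "bounded_linear (block_op A B C D)"
    unfolding *
    by (intro bounded_linear_Pair bounded_linear_add
        bounded_linear_compose [OF _ bounded_linear_fst]
        bounded_linear_compose [OF _ bounded_linear_snd]) (use lin in auto)
  moreover have "block_op A B C D (c *\<^sub>C x) = c *\<^sub>C block_op A B C D x" for c x
    using lin by (simp add: * scaleC_prod_def scaleC_add_right)
  ultimately show ?thesis
    by (simp add: bounded_clinear_def)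
qed

text \<open>
  The supremum of the empty set is unspecified for type \<^typ>\<open>real\<close>; it is read as 0 here.
  It arises for the numerical radii when the space has dimension 0, or dimension 1 with
  \<open>q < 1\<close>.
\<close>

definition Sup0 :: "real set \<Rightarrow> real"
  where "Sup0 S = (if S = {} then 0 else Sup S)"

definition numerical_radius :: "('a::complex_inner \<Rightarrow> 'a) \<Rightarrow> real"
  where "numerical_radius T = Sup0 {cmod (cinner (T x) x) | x. norm x = 1}"

definition q_numerical_radius :: "real \<Rightarrow> ('a::complex_inner \<Rightarrow> 'a) \<Rightarrow> real"
  where "q_numerical_radius q T =
    Sup0 {cmod (cinner (T x) y) | x y. norm x = 1 \<and> norm y = 1 \<and> cinner x y = complex_of_real q}"

end

theory Submission
  imports Defs
begin

text \<open>
  Everything rests on splitting the second vector along the first: if \<open>x\<close> and \<open>y\<close> are unit vectors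
  with \<open>\<langle>x, y\<rangle> = q\<close>, then \<open>y = q x + z\<close> with \<open>\<parallel>z\<parallel> = sqrt (1 - q\<^sup>2)\<close> (\<open>norm_orthogonal_part\<close>).

  For the third inequality, \<open>\<langle>Tx, y\<rangle>\<close> becomes \<open>q \<langle>Tx, x\<rangle> + \<langle>Tx, z\<rangle>\<close>.  The first term is \<open>q\<close> times a value
  of the quadratic form of \<open>T\<close>, which the numerical radii of \<open>A\<close> and \<open>D\<close> and the norms of \<open>B\<close> and \<open>C\<close> control
  (\<open>cmod_cinner_block_op_self_le\<close>); the second is at most \<open>sqrt (1 - q\<^sup>2) \<parallel>T\<parallel>\<close>, and \<open>\<parallel>T\<parallel>\<close> is at most
  the Hilbert-Schmidt norm of the 2 by 2 matrix of the operator norms of the entries (\<open>norm_block_op_le\<close>).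

  For the second inequality, the diagonal entries contribute at most
  \<open>max \<parallel>A\<parallel> \<parallel>D\<parallel>\<close> by Cauchy-Schwarz in the plane, and each off-diagonal entry contributes its norm times a
  product of the form \<open>\<parallel>x\<^sub>2\<parallel> \<parallel>y\<^sub>1\<parallel>\<close>.  By the splitting, this product is at most
  \<open>q \<parallel>x\<^sub>1\<parallel> \<parallel>x\<^sub>2\<parallel> + \<parallel>z\<parallel> \<le> q/2 + sqrt (1 - q\<^sup>2)\<close> (\<open>cross_norm_product_le\<close>), and the right-hand side is
  the square root in the claim, since its square is \<open>1 - 3q\<^sup>2/4 + q sqrt (1 - q\<^sup>2)\<close>.

  For the first inequality, the diagonal entries are compressions of the block operator: pairs of unit
  vectors in a summand stay admissible in the direct sum.  The off-diagonal part equals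
  \<open>(T - U T U)/2\<close> for the unitary \<open>U = diag (1, -1)\<close>, and conjugation by a unitary maps admissible
  pairs to admissible pairs (\<open>q_numerical_radius_offdiagonal_le\<close>).
\<close>

section \<open>Complex inner products\<close>

lemma cinner_add_right: "cinner x (y + z) = cinner x y + cinner x z"
  for x :: "'a::complex_inner"
  by (metis cinner_commute cinner_add_left complex_cnj_add)

lemma cinner_scaleC_right: "cinner x (c *\<^sub>C y) = cnj c * cinner x y"
  for x :: "'a::complex_inner"
  by (metis cinner_commute cinner_scaleC_left complex_cnj_mult)

lemma cinner_scaleR_left: "cinner (r *\<^sub>R x) y = of_real r * cinner x y"
  for x :: "'a::complex_inner"
  by (simp add: scaleR_scaleC cinner_scaleC_left)

lemma cinner_scaleR_right: "cinner x (r *\<^sub>R y) = of_real r * cinner x y"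
  for x :: "'a::complex_inner"
  by (simp add: scaleR_scaleC cinner_scaleC_right)

lemma cinner_minus_left: "cinner (- x) y = - cinner x y"
  for x :: "'a::complex_inner"
  using cinner_scaleR_left [of "- 1" x y] by simp

lemma cinner_minus_right: "cinner x (- y) = - cinner x y"
  for x :: "'a::complex_inner"
  using cinner_scaleR_right [of x "- 1" y] by simp

lemma cinner_diff_left: "cinner (x - y) z = cinner x z - cinner y z"
  for x :: "'a::complex_inner"
  using cinner_add_left [of x "- y" z] by (simp add: cinner_minus_left)

lemma cinner_diff_right: "cinner x (y - z) = cinner x y - cinner x z"
  for x :: "'a::complex_inner"
  using cinner_add_right [of x y "- z"] by (simp add: cinner_minus_right)

lemma cinner_zero_left [simp]: "cinner 0 y = 0"
  for y :: "'a::complex_inner"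
  using cinner_scaleR_left [of 0 0 y] by simp

lemma cinner_zero_right [simp]: "cinner x 0 = 0"
  for x :: "'a::complex_inner"
  using cinner_scaleR_right [of x 0 0] by simp

lemma cinner_self: "cinner x x = complex_of_real ((norm x)\<^sup>2)"
  for x :: "'a::complex_inner"
proof -
  have "Im (cinner x x) = 0"
    using cinner_commute [of x x] by (simp add: complex_eq_iff)
  then show ?thesis
    by (simp add: complex_eq_iff norm_eq_sqrt_cinner cinner_ge_zero)
qed

text \<open>
  Cauchy-Schwarz: the vector \<open>\<parallel>y\<parallel>\<^sup>2 x - \<langle>x, y\<rangle> y\<close> is a multiple of the part of \<open>x\<close> orthogonal to
  \<open>y\<close>, and its squared norm is \<open>\<parallel>y\<parallel>\<^sup>2 (\<parallel>x\<parallel>\<^sup>2 \<parallel>y\<parallel>\<^sup>2 - |\<langle>x, y\<rangle>|\<^sup>2)\<close>.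
\<close>

lemma cmod_cinner_le: "cmod (cinner x y) \<le> norm x * norm y"
  for x :: "'a::complex_inner"
proof (cases "y = 0")
  case False
  define c where "c = cinner x y"
  define n where "n = (norm y)\<^sup>2"
  define v where "v = n *\<^sub>R x - c *\<^sub>C y"
  have "cinner v v = of_real n * (of_real n * of_real ((norm x)\<^sup>2) - c * cnj c)"
    unfolding v_def cinner_diff_left cinner_diff_right cinner_scaleR_left cinner_scaleR_right
      cinner_scaleC_left cinner_scaleC_right
    unfolding cinner_self
    using cinner_commute [of y x]
    by (simp add: c_def n_def algebra_simps)
  also have "\<dots> = of_real (n * (n * (norm x)\<^sup>2 - (cmod c)\<^sup>2))"
    by (simp add: complex_norm_square [symmetric])
  finally have "(norm v)\<^sup>2 = n * (n * (norm x)\<^sup>2 - (cmod c)\<^sup>2)"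
    unfolding cinner_self of_real_eq_iff .
  then have "0 \<le> n * (n * (norm x)\<^sup>2 - (cmod c)\<^sup>2)"
    by (metis zero_le_power2)
  moreover have "n > 0"
    using False by (simp add: n_def)
  ultimately have "(cmod c)\<^sup>2 \<le> (norm x * norm y)\<^sup>2"
    by (simp add: zero_le_mult_iff n_def power_mult_distrib mult.commute)
  then show ?thesis
    unfolding c_def by (rule power2_le_imp_le) simp
qed simp

lemma cmod_cinner_apply_le:
  assumes "bounded_linear T"
  shows "cmod (cinner (T x) y) \<le> onorm T * norm x * norm y"
  using cmod_cinner_le [of "T x" y] mult_right_mono [OF onorm [OF assms, of x], of "norm y"]
  by simp

text \<open>The vector \<open>y - q x\<close> is the part of \<open>y\<close> orthogonal to \<open>x\<close>, so this is Pythagoras.\<close>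

lemma norm_orthogonal_part:
  fixes x y :: "'a::complex_inner"
  assumes "norm x = 1" "norm y = 1" "cinner x y = complex_of_real q"
  shows "norm (y - q *\<^sub>R x) = sqrt (1 - q\<^sup>2)"
proof -
  have yx: "cinner y x = complex_of_real q"
    using cinner_commute [of y x] assms by simp
  have "cinner (y - q *\<^sub>R x) (y - q *\<^sub>R x) = of_real (1 - q\<^sup>2)"
    unfolding cinner_diff_left cinner_diff_right cinner_scaleR_left cinner_scaleR_right
    unfolding cinner_self yx assms
    by (simp add: power2_eq_square)
  then have "(norm (y - q *\<^sub>R x))\<^sup>2 = 1 - q\<^sup>2"
    unfolding cinner_self of_real_eq_iff .
  then show ?thesis
    by (metis norm_ge_zero real_sqrt_unique)
qed

section \<open>Numerical radii of bounded operators\<close>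

lemma q_numerical_radius_ge:
  fixes T :: "'a::complex_inner \<Rightarrow> 'a"
  assumes "bounded_linear T" "norm x = 1" "norm y = 1" "cinner x y = complex_of_real q"
  shows "cmod (cinner (T x) y) \<le> q_numerical_radius q T"
proof -
  let ?S = "{cmod (cinner (T x) y) |x y.
    norm x = 1 \<and> norm y = 1 \<and> cinner x y = complex_of_real q}"
  have "cmod (cinner (T u) v) \<le> onorm T" if "norm u = 1" "norm v = 1" for u v
    using cmod_cinner_apply_le [OF assms(1), of u v] that by simp
  then have "bdd_above ?S"
    unfolding bdd_above_def by blast
  moreover have "cmod (cinner (T x) y) \<in> ?S"
    using assms by blast
  ultimately show ?thesis
    unfolding q_numerical_radius_def Sup0_def by (auto intro: cSup_upper)
qed

text \<open>
  Nonnegativity of \<open>M\<close> covers the case where no pair of unit vectors is admissible.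
\<close>

lemma q_numerical_radius_le:
  fixes T :: "'a::complex_inner \<Rightarrow> 'a"
  assumes "0 \<le> M"
    and "\<And>x y. norm x = 1 \<Longrightarrow> norm y = 1 \<Longrightarrow> cinner x y = complex_of_real q \<Longrightarrow>
      cmod (cinner (T x) y) \<le> M"
  shows "q_numerical_radius q T \<le> M"
  unfolding q_numerical_radius_def Sup0_def using assms by (auto intro!: cSup_least)

lemma q_numerical_radius_nonneg:
  fixes T :: "'a::complex_inner \<Rightarrow> 'a"
  assumes "bounded_linear T"
  shows "0 \<le> q_numerical_radius q T"
proof (cases "\<exists>x y :: 'a. norm x = 1 \<and> norm y = 1 \<and> cinner x y = complex_of_real q")
  case True
  then show ?thesis
    using q_numerical_radius_ge [OF assms] norm_ge_zero order_trans by metis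
next
  case False
  then show ?thesis
    unfolding q_numerical_radius_def Sup0_def by auto
qed

text \<open>
  For \<open>q = 1\<close> the admissible pairs are exactly the pairs of equal unit vectors, because the
  part of \<open>y\<close> orthogonal to \<open>x\<close> then has norm 0; so facts about the numerical radius are instances of
  those about the \<open>q\<close>-numerical radius.
\<close>

lemma numerical_radius_eq: "numerical_radius T = q_numerical_radius 1 T"
  for T :: "'a::complex_inner \<Rightarrow> 'a"
proof -
  have "norm x = 1 \<and> norm y = 1 \<and> cinner x y = complex_of_real 1 \<longleftrightarrow> norm x = 1 \<and> y = x"
    for x y :: 'a
    using norm_orthogonal_part [of x y 1] by (auto simp: cinner_self)
  then show ?thesis
    unfolding numerical_radius_def q_numerical_radius_def by simp
qed

lemma cmod_cinner_self_le_numerical_radius: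
  fixes T :: "'a::complex_inner \<Rightarrow> 'a"
  assumes "bounded_linear T"
  shows "cmod (cinner (T x) x) \<le> numerical_radius T * (norm x)\<^sup>2"
proof (cases "x = 0")
  case False
  define u where "u = (1 / norm x) *\<^sub>R x"
  have x: "norm x *\<^sub>R u = x" and u: "norm u = 1"
    using False by (simp_all add: u_def)
  have "cinner (T (r *\<^sub>R u)) (r *\<^sub>R u) = of_real (r\<^sup>2) * cinner (T u) u" for r
    by (simp add: linear_scale [OF bounded_linear.linear [OF assms]]
        cinner_scaleR_left cinner_scaleR_right power2_eq_square)
  from this [of "norm x"] have "cinner (T x) x = of_real ((norm x)\<^sup>2) * cinner (T u) u"
    unfolding x .
  then have "cmod (cinner (T x) x) = cmod (cinner (T u) u) * (norm x)\<^sup>2"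
    by (simp add: norm_mult norm_power)
  moreover have "cmod (cinner (T u) u) \<le> numerical_radius T"
    unfolding numerical_radius_eq
    by (rule q_numerical_radius_ge [OF assms u u]) (simp add: cinner_self u)
  ultimately show ?thesis
    by (simp add: mult_right_mono)
qed (simp add: linear_0 [OF bounded_linear.linear [OF assms]])

section \<open>Block operators\<close>

lemma block_op_apply: "block_op A B C D x = (A (fst x) + B (snd x), C (fst x) + D (snd x))"
  by (simp add: block_op_def case_prod_unfold)

lemma cinner_block_op:
  "cinner (block_op A B C D x) y =
    cinner (A (fst x)) (fst y) + cinner (B (snd x)) (fst y) +
    cinner (C (fst x)) (snd y) + cinner (D (snd x)) (snd y)"
  by (simp add: block_op_apply cinner_prod_def cinner_add_left)

lemma cmod_cinner_block_op_le:
  "cmod (cinner (block_op A B C D x) y) \<le>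
    cmod (cinner (A (fst x)) (fst y)) + cmod (cinner (B (snd x)) (fst y)) +
    cmod (cinner (C (fst x)) (snd y)) + cmod (cinner (D (snd x)) (snd y))"
  unfolding cinner_block_op by (intro norm_triangle_le add_mono order_refl)

lemma norm_prod_power2: "(norm x)\<^sup>2 = (norm (fst x))\<^sup>2 + (norm (snd x))\<^sup>2"
  for x :: "'a::real_normed_vector \<times> 'b::real_normed_vector"
  by (simp add: norm_prod_def)

lemma norm_fst_mult_norm_snd_le: "norm (fst x) * norm (snd x) \<le> (norm x)\<^sup>2 / 2"
  for x :: "'a::real_normed_vector \<times> 'b::real_normed_vector"
  using sum_squares_bound [of "norm (fst x)" "norm (snd x)"] by (simp add: norm_prod_power2)

lemma cauchy_schwarz_plane:
  "a * c + b * d \<le> sqrt (a\<^sup>2 + b\<^sup>2) * sqrt (c\<^sup>2 + d\<^sup>2)" for a b c d :: real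
proof -
  have "inner (a, b) (c, d) \<le> norm (a, b) * norm (c, d)"
    by (rule norm_cauchy_schwarz)
  then show ?thesis
    by (simp add: norm_prod_def)
qed

text \<open>
  The trivial bound for these products is 1.  Writing \<open>y = q x + z\<close> improves it for large
  \<open>q\<close>, because \<open>\<parallel>x\<^sub>1\<parallel> \<parallel>x\<^sub>2\<parallel> \<le> 1/2\<close>.
\<close>

lemma cross_norm_product_le:
  fixes x y :: "'a::complex_inner \<times> 'b::complex_inner"
  assumes "norm x = 1" "norm y = 1" "cinner x y = complex_of_real q" "0 \<le> q"
  shows "norm (snd x) * norm (fst y) \<le> q / 2 + sqrt (1 - q\<^sup>2)"
    and "norm (fst x) * norm (snd y) \<le> q / 2 + sqrt (1 - q\<^sup>2)"
proof -
  define z where "z = y - q *\<^sub>R x"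
  have nz: "norm z = sqrt (1 - q\<^sup>2)"
    unfolding z_def using assms(1-3) by (rule norm_orthogonal_part)
  have y: "y = q *\<^sub>R x + z"
    by (simp add: z_def)
  have half: "q * (norm (fst x) * norm (snd x)) \<le> q / 2"
    using mult_left_mono [OF norm_fst_mult_norm_snd_le [of x] \<open>0 \<le> q\<close>] assms(1) by simp
  \<comment> \<open>The two products differ only by exchanging the summands: \<open>u\<close> and \<open>w\<close> stand for the norms of the
    two components of \<open>x\<close>, and \<open>v\<close> and \<open>r\<close> for those of \<open>y\<close> and \<open>z\<close> on the side of \<open>w\<close>.\<close>
  have product_le: "u * v \<le> q / 2 + sqrt (1 - q\<^sup>2)"
    if "0 \<le> u" "u \<le> 1" "u * w = norm (fst x) * norm (snd x)" "v \<le> q * w + r" "r \<le> norm z" "0 \<le> r"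
    for u v w r :: real
  proof -
    have "u * v \<le> q * (u * w) + u * r"
      using mult_left_mono [OF that(4,1)] by (simp add: algebra_simps)
    also have "u * r \<le> norm z"
      using mult_mono [of u 1 r "norm z"] that by simp
    finally show ?thesis
      using half that(3) nz by simp
  qed
  have "norm (fst y) \<le> q * norm (fst x) + norm (fst z)"
    using norm_triangle_ineq [of "q *\<^sub>R fst x" "fst z"] \<open>0 \<le> q\<close> by (simp add: y)
  then show "norm (snd x) * norm (fst y) \<le> q / 2 + sqrt (1 - q\<^sup>2)"
    using norm_fst_le [of "fst z" "snd z"] norm_snd_le [of "snd x" "fst x"] assms(1)
    by (intro product_le [of _ "norm (fst x)" _ "norm (fst z)"]) (simp_all add: mult.commute)
  have "norm (snd y) \<le> q * norm (snd x) + norm (snd z)"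
    using norm_triangle_ineq [of "q *\<^sub>R snd x" "snd z"] \<open>0 \<le> q\<close> by (simp add: y)
  then show "norm (fst x) * norm (snd y) \<le> q / 2 + sqrt (1 - q\<^sup>2)"
    using norm_snd_le [of "snd z" "fst z"] norm_fst_le [of "fst x" "snd x"] assms(1)
    by (intro product_le [of _ "norm (snd x)" _ "norm (snd z)"]) simp_all
qed

text \<open>
  In both rows the triangle inequality leaves a scalar product of a row of operator norms with
  \<open>(\<parallel>x\<^sub>1\<parallel>, \<parallel>x\<^sub>2\<parallel>)\<close>, so Cauchy-Schwarz in the plane applies row by row.
\<close>

lemma norm_block_op_le:
  assumes "bounded_linear A" "bounded_linear B" "bounded_linear C" "bounded_linear D"
  shows "norm (block_op A B C D x) \<le>
    sqrt ((onorm A)\<^sup>2 + (onorm B)\<^sup>2 + (onorm C)\<^sup>2 + (onorm D)\<^sup>2) * norm x"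
proof -
  have row: "(norm (E (fst x) + F (snd x)))\<^sup>2 \<le> ((onorm E)\<^sup>2 + (onorm F)\<^sup>2) * (norm x)\<^sup>2"
    if "bounded_linear E" "bounded_linear F"
    for E :: "'a \<Rightarrow> 'c::real_normed_vector" and F :: "'b \<Rightarrow> 'c"
  proof -
    have "norm (E (fst x) + F (snd x)) \<le> onorm E * norm (fst x) + onorm F * norm (snd x)"
      by (intro order_trans [OF norm_triangle_ineq] add_mono onorm that)
    also have "\<dots> \<le> sqrt ((onorm E)\<^sup>2 + (onorm F)\<^sup>2) * norm x"
      unfolding norm_prod_def by (rule cauchy_schwarz_plane)
    finally show ?thesis
      using power_mono [OF _ norm_ge_zero, of "E (fst x) + F (snd x)" _ 2]
      by (force simp: power_mult_distrib)
  qed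
  let ?s = "(onorm A)\<^sup>2 + (onorm B)\<^sup>2 + (onorm C)\<^sup>2 + (onorm D)\<^sup>2"
  have "(norm (block_op A B C D x))\<^sup>2 \<le>
      ((onorm A)\<^sup>2 + (onorm B)\<^sup>2) * (norm x)\<^sup>2 + ((onorm C)\<^sup>2 + (onorm D)\<^sup>2) * (norm x)\<^sup>2"
    unfolding norm_prod_power2 [of "block_op A B C D x"]
    unfolding block_op_apply fst_conv snd_conv
    by (intro add_mono row assms)
  also have "\<dots> = ?s * (norm x)\<^sup>2"
    by (simp only: distrib_right add.assoc)
  also have "\<dots> = (sqrt ?s * norm x)\<^sup>2"
    by (simp add: power_mult_distrib)
  finally show ?thesis
    by (rule power2_le_imp_le) simp
qed

text \<open>
  The diagonal terms form a combination of the two numerical radii with weights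
  \<open>\<parallel>x\<^sub>1\<parallel>\<^sup>2 + \<parallel>x\<^sub>2\<parallel>\<^sup>2 = 1\<close>; the constant 1/2 bounds \<open>\<parallel>x\<^sub>1\<parallel> \<parallel>x\<^sub>2\<parallel>\<close> in the off-diagonal terms.
\<close>

lemma cmod_cinner_block_op_self_le:
  assumes "bounded_linear A" "bounded_linear B" "bounded_linear C" "bounded_linear D"
    and "norm x = 1"
  shows "cmod (cinner (block_op A B C D x) x) \<le>
    max (numerical_radius A) (numerical_radius D) + (onorm B + onorm C) / 2"
proof -
  let ?w = "max (numerical_radius A) (numerical_radius D)"
  have half: "norm (fst x) * norm (snd x) \<le> 1 / 2"
    using norm_fst_mult_norm_snd_le [of x] assms(5) by simp
  have "cmod (cinner (A (fst x)) (fst x)) \<le> ?w * (norm (fst x))\<^sup>2"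
    by (rule order_trans [OF cmod_cinner_self_le_numerical_radius [OF assms(1)]])
      (simp add: mult_right_mono)
  moreover have "cmod (cinner (D (snd x)) (snd x)) \<le> ?w * (norm (snd x))\<^sup>2"
    by (rule order_trans [OF cmod_cinner_self_le_numerical_radius [OF assms(4)]])
      (simp add: mult_right_mono)
  moreover have "?w * (norm (fst x))\<^sup>2 + ?w * (norm (snd x))\<^sup>2 = ?w"
    using norm_prod_power2 [of x] assms(5) by (simp flip: distrib_left)
  moreover have "cmod (cinner (B (snd x)) (fst x)) \<le> onorm B / 2"
    using cmod_cinner_apply_le [OF assms(2), of "snd x" "fst x"]
      mult_left_mono [OF half onorm_pos_le [OF assms(2)]] by (simp add: ac_simps)
  moreover have "cmod (cinner (C (fst x)) (snd x)) \<le> onorm C / 2"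
    using cmod_cinner_apply_le [OF assms(3), of "fst x" "snd x"]
      mult_left_mono [OF half onorm_pos_le [OF assms(3)]] by (simp add: ac_simps)
  ultimately show ?thesis
    using cmod_cinner_block_op_le [of A B C D x x] unfolding add_divide_distrib by linarith
qed

section \<open>Bounds for the q-numerical radius of a block operator\<close>

context
  fixes A :: "'a::complex_inner \<Rightarrow> 'a"
    and B :: "'b::complex_inner \<Rightarrow> 'a"
    and C :: "'a \<Rightarrow> 'b"
    and D :: "'b \<Rightarrow> 'b"
  assumes clinear: "bounded_clinear A" "bounded_clinear B" "bounded_clinear C" "bounded_clinear D"
begin

private lemma bounded_linear_entries:
  "bounded_linear A" "bounded_linear B" "bounded_linear C" "bounded_linear D"
  using clinear by (simp_all add: bounded_clinear_def)

private lemma bounded_linear_block: "bounded_linear (block_op A B C D)"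
  using bounded_clinear_block_op [OF clinear] by (simp add: bounded_clinear_def)

lemma q_numerical_radius_upper_left_le:
  "q_numerical_radius q A \<le> q_numerical_radius q (block_op A B C D)"
proof (rule q_numerical_radius_le [OF q_numerical_radius_nonneg [OF bounded_linear_block]])
  fix x y :: 'a
  assume "norm x = 1" "norm y = 1" "cinner x y = complex_of_real q"
  then have "cmod (cinner (block_op A B C D (x, 0)) (y, 0)) \<le> q_numerical_radius q (block_op A B C D)"
    by (intro q_numerical_radius_ge [OF bounded_linear_block]) (simp_all add: cinner_prod_def)
  then show "cmod (cinner (A x) y) \<le> q_numerical_radius q (block_op A B C D)"
    by (simp add: cinner_block_op linear_0 [OF bounded_linear.linear] bounded_linear_entries)
qed

lemma q_numerical_radius_lower_right_le:
  "q_numerical_radius q D \<le> q_numerical_radius q (block_op A B C D)"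
proof (rule q_numerical_radius_le [OF q_numerical_radius_nonneg [OF bounded_linear_block]])
  fix x y :: 'b
  assume "norm x = 1" "norm y = 1" "cinner x y = complex_of_real q"
  then have "cmod (cinner (block_op A B C D (0, x)) (0, y)) \<le> q_numerical_radius q (block_op A B C D)"
    by (intro q_numerical_radius_ge [OF bounded_linear_block]) (simp_all add: cinner_prod_def)
  then show "cmod (cinner (D x) y) \<le> q_numerical_radius q (block_op A B C D)"
    by (simp add: cinner_block_op linear_0 [OF bounded_linear.linear] bounded_linear_entries)
qed

text \<open>
  Conjugation by the unitary \<open>U = diag (1, -1)\<close> fixes the diagonal entries and negates the
  off-diagonal ones, so \<open>2 \<langle>Sx, y\<rangle> = \<langle>Tx, y\<rangle> - \<langle>TUx, Uy\<rangle>\<close> for the off-diagonal part \<open>S\<close> of \<open>T\<close>;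
  both terms on the right are bounded by the radius of \<open>T\<close>.
\<close>

lemma q_numerical_radius_offdiagonal_le:
  "q_numerical_radius q (block_op (\<lambda>_. 0) B C (\<lambda>_. 0)) \<le> q_numerical_radius q (block_op A B C D)"
proof (rule q_numerical_radius_le [OF q_numerical_radius_nonneg [OF bounded_linear_block]])
  fix x y :: "'a \<times> 'b"
  assume xy: "norm x = 1" "norm y = 1" "cinner x y = complex_of_real q"
  let ?T = "block_op A B C D"
  define U :: "'a \<times> 'b \<Rightarrow> 'a \<times> 'b" where "U = (\<lambda>v. (fst v, - snd v))"
  have "norm (U v) = norm v" for v
    by (simp add: U_def norm_prod_def)
  moreover have "cinner (U x) (U y) = cinner x y"
    by (simp add: U_def cinner_prod_def cinner_minus_left cinner_minus_right)
  ultimately have "cmod (cinner (?T (U x)) (U y)) \<le> q_numerical_radius q ?T"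
    using xy by (intro q_numerical_radius_ge [OF bounded_linear_block]) simp_all
  moreover have "cmod (cinner (?T x) y) \<le> q_numerical_radius q ?T"
    using xy by (intro q_numerical_radius_ge [OF bounded_linear_block])
  moreover have "2 * cinner (block_op (\<lambda>_. 0) B C (\<lambda>_. 0) x) y =
      cinner (?T x) y - cinner (?T (U x)) (U y)"
    by (simp add: U_def cinner_block_op cinner_minus_left cinner_minus_right
        linear_neg [OF bounded_linear.linear] bounded_linear_entries)
  then have "2 * cmod (cinner (block_op (\<lambda>_. 0) B C (\<lambda>_. 0) x) y) \<le>
      cmod (cinner (?T x) y) + cmod (cinner (?T (U x)) (U y))"
    using norm_triangle_ineq4 [of "cinner (?T x) y" "cinner (?T (U x)) (U y)"]
    by (metis norm_mult norm_numeral)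
  ultimately show "cmod (cinner (block_op (\<lambda>_. 0) B C (\<lambda>_. 0) x) y) \<le> q_numerical_radius q ?T"
    by linarith
qed

lemma q_numerical_radius_block_op_le_norms:
  assumes "0 \<le> q" "q \<le> 1"
  shows "q_numerical_radius q (block_op A B C D) \<le>
    max (onorm A) (onorm D) + (q / 2 + sqrt (1 - q\<^sup>2)) * (onorm B + onorm C)"
proof (rule q_numerical_radius_le)
  note pos = onorm_pos_le [OF bounded_linear_entries(1)] onorm_pos_le [OF bounded_linear_entries(2)]
    onorm_pos_le [OF bounded_linear_entries(3)] onorm_pos_le [OF bounded_linear_entries(4)]
  have "0 \<le> q / 2 + sqrt (1 - q\<^sup>2)"
    using assms by (simp add: power_le_one)
  then show "0 \<le> max (onorm A) (onorm D) + (q / 2 + sqrt (1 - q\<^sup>2)) * (onorm B + onorm C)"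
    using pos by (simp add: le_max_iff_disj)
  fix x y :: "'a \<times> 'b"
  assume xy: "norm x = 1" "norm y = 1" "cinner x y = complex_of_real q"
  let ?m = "max (onorm A) (onorm D)" and ?k = "q / 2 + sqrt (1 - q\<^sup>2)"
  have "norm (fst x) * norm (fst y) + norm (snd x) * norm (snd y) \<le> norm x * norm y"
    unfolding norm_prod_def by (rule cauchy_schwarz_plane)
  then have "?m * (norm (fst x) * norm (fst y) + norm (snd x) * norm (snd y)) \<le> ?m"
    using mult_left_le [of "norm (fst x) * norm (fst y) + norm (snd x) * norm (snd y)" ?m] pos(1) xy
    by (simp add: le_max_iff_disj)
  moreover have "cmod (cinner (A (fst x)) (fst y)) \<le> ?m * (norm (fst x) * norm (fst y))"
    by (rule order_trans [OF cmod_cinner_apply_le [OF bounded_linear_entries(1)]])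
      (simp add: mult.assoc mult_right_mono)
  moreover have "cmod (cinner (D (snd x)) (snd y)) \<le> ?m * (norm (snd x) * norm (snd y))"
    by (rule order_trans [OF cmod_cinner_apply_le [OF bounded_linear_entries(4)]])
      (simp add: mult.assoc mult_right_mono)
  ultimately have diagonal:
    "cmod (cinner (A (fst x)) (fst y)) + cmod (cinner (D (snd x)) (snd y)) \<le> ?m"
    by (simp add: distrib_left)
  note cross = cross_norm_product_le [OF xy \<open>0 \<le> q\<close>]
  have "cmod (cinner (B (snd x)) (fst y)) \<le> ?k * onorm B"
    using cmod_cinner_apply_le [OF bounded_linear_entries(2), of "snd x" "fst y"]
      mult_right_mono [OF cross(1) pos(2)] by (simp add: ac_simps)
  moreover have "cmod (cinner (C (fst x)) (snd y)) \<le> ?k * onorm C"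
    using cmod_cinner_apply_le [OF bounded_linear_entries(3), of "fst x" "snd y"]
      mult_right_mono [OF cross(2) pos(3)] by (simp add: ac_simps)
  ultimately show "cmod (cinner (block_op A B C D x) y) \<le> ?m + ?k * (onorm B + onorm C)"
    using cmod_cinner_block_op_le [of A B C D x y] diagonal
    unfolding distrib_left [of ?k] by linarith
qed

lemma q_numerical_radius_block_op_le_numerical_radii:
  assumes "0 \<le> q" "q \<le> 1"
  shows "q_numerical_radius q (block_op A B C D) \<le>
    sqrt (1 - q\<^sup>2) * sqrt ((onorm A)\<^sup>2 + (onorm B)\<^sup>2 + (onorm C)\<^sup>2 + (onorm D)\<^sup>2) +
    q * (max (numerical_radius A) (numerical_radius D) + (onorm B + onorm C) / 2)"
    (is "_ \<le> sqrt (1 - q\<^sup>2) * ?s + q * ?w")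
proof (rule q_numerical_radius_le)
  have "0 \<le> numerical_radius A"
    unfolding numerical_radius_eq
    by (rule q_numerical_radius_nonneg [OF bounded_linear_entries(1)])
  then have "0 \<le> ?w"
    using onorm_pos_le [OF bounded_linear_entries(2)] onorm_pos_le [OF bounded_linear_entries(3)]
    by simp
  then show "0 \<le> sqrt (1 - q\<^sup>2) * ?s + q * ?w"
    using assms by (simp add: power_le_one)
  fix x y :: "'a \<times> 'b"
  assume xy: "norm x = 1" "norm y = 1" "cinner x y = complex_of_real q"
  let ?T = "block_op A B C D"
  define z where "z = y - q *\<^sub>R x"
  have "cinner (?T x) y = cinner (?T x) z + of_real q * cinner (?T x) x"
    by (simp add: z_def cinner_diff_right cinner_scaleR_right)
  then have "cmod (cinner (?T x) y) \<le> cmod (cinner (?T x) z) + q * cmod (cinner (?T x) x)"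
    using norm_triangle_ineq [of "cinner (?T x) z" "of_real q * cinner (?T x) x"] assms(1)
    by (simp add: norm_mult)
  moreover have "cmod (cinner (?T x) z) \<le> sqrt (1 - q\<^sup>2) * ?s"
  proof -
    have "cmod (cinner (?T x) z) \<le> norm (?T x) * norm z"
      by (rule cmod_cinner_le)
    also have "\<dots> \<le> ?s * norm z"
      using norm_block_op_le [OF bounded_linear_entries, of x] xy(1)
      by (simp add: mult_right_mono)
    finally show ?thesis
      using norm_orthogonal_part [OF xy] by (simp add: z_def mult.commute)
  qed
  moreover have "q * cmod (cinner (?T x) x) \<le> q * ?w"
    using cmod_cinner_block_op_self_le [OF bounded_linear_entries xy(1)] assms(1)
    by (rule mult_left_mono)
  ultimately show "cmod (cinner (?T x) y) \<le> sqrt (1 - q\<^sup>2) * ?s + q * ?w"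
    by linarith
qed

end

theorem theorem3p3:
  fixes A :: "'a::chilbert_space \<Rightarrow> 'a"
    and B :: "'b::chilbert_space \<Rightarrow> 'a"
    and C :: "'a \<Rightarrow> 'b"
    and D :: "'b \<Rightarrow> 'b"
    and q :: real
  assumes "bounded_clinear A" and "bounded_clinear B"
    and "bounded_clinear C" and "bounded_clinear D"
    and "0 \<le> q" and "q \<le> 1"
  shows "Max {q_numerical_radius q A, q_numerical_radius q D,
              q_numerical_radius q (block_op (\<lambda>_. 0) B C (\<lambda>_. 0))}
           \<le> q_numerical_radius q (block_op A B C D)
       \<and> q_numerical_radius q (block_op A B C D)
           \<le> max (onorm A) (onorm D)
             + sqrt (1 - 3 * q\<^sup>2 / 4 + q * sqrt (1 - q\<^sup>2)) * (onorm B + onorm C)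
       \<and> q_numerical_radius q (block_op A B C D)
           \<le> sqrt (1 - q\<^sup>2) * sqrt ((onorm A)\<^sup>2 + (onorm B)\<^sup>2 + (onorm C)\<^sup>2 + (onorm D)\<^sup>2)
             + q * (max (numerical_radius A) (numerical_radius D) + (onorm B + onorm C) / 2)"
proof -
  have "sqrt (1 - 3 * q\<^sup>2 / 4 + q * sqrt (1 - q\<^sup>2)) = q / 2 + sqrt (1 - q\<^sup>2)"
  proof (rule real_sqrt_unique)
    have "(sqrt (1 - q\<^sup>2))\<^sup>2 = 1 - q\<^sup>2"
      using assms(5,6) by (simp add: power_le_one)
    then show "(q / 2 + sqrt (1 - q\<^sup>2))\<^sup>2 = 1 - 3 * q\<^sup>2 / 4 + q * sqrt (1 - q\<^sup>2)"
      by (simp add: power2_sum power_divide)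
    show "0 \<le> q / 2 + sqrt (1 - q\<^sup>2)"
      using assms(5,6) by (simp add: power_le_one)
  qed
  then show ?thesis
    using q_numerical_radius_upper_left_le [OF assms(1-4), of q]
      q_numerical_radius_lower_right_le [OF assms(1-4), of q]
      q_numerical_radius_offdiagonal_le [OF assms(1-4), of q]
      q_numerical_radius_block_op_le_norms [OF assms]
      q_numerical_radius_block_op_le_numerical_radii [OF assms]
    by simp
qed

end
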